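(* There exists a $(121,11;9)$ Heffter net over the additive group of $\mathbb F_{3^5}$.
   Context: A half-set of an abelian group $G$ of odd order $2v+1\ge7$ is a subset $V\subseteq G\setminus\{0\}$ containing exactly one element of each pair $\{g,-g\}$, $g\ne0$. A $(v,k)$ Heffter system on $V$ is a partition of $V$ into blocks of size $k$ each summing to $0$ in $G$. A $(k^2,k;r)$ Heffter net over $G$ (with $|G|=2k^2+1$) is a partial linear space (any two distinct points lie in at most one block) whose point set is a half-set $V$ of $G$, with a resolution of its blocks into $r$ parallel classes (each a partition of $V$), each of which is a $(k^2,k)$ Heffter system. *)

theory Defs
  imports "HOL-Analysis.Finite_Cartesian_Product" "HOL-Library.Numeral_Type" "HOL-Library.Disjoint_Sets"
begin

text \<open>The additive group of GF(3^5) is the elementary abelian group (Z/3Z)^5,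
  rendered as the type 3 ^ 5 (vectors of length 5 over the integers mod 3).\<close>
type_synonym additive_GF243 = "3 ^ 5"

definition half_set :: "'a::ab_group_add set \<Rightarrow> bool" where
  "half_set V \<longleftrightarrow> 0 \<notin> V \<and> (\<forall>g. g \<noteq> 0 \<longrightarrow> (g \<in> V \<longleftrightarrow> - g \<notin> V))"

definition heffter_system :: "nat \<Rightarrow> nat \<Rightarrow> 'a::ab_group_add set \<Rightarrow> 'a set set \<Rightarrow> bool" where
  "heffter_system v k V P \<longleftrightarrow>
     card V = v \<and> partition_on V P \<and> (\<forall>B\<in>P. card B = k \<and> \<Sum>B = 0)"

text \<open>A (k^2,k;r) Heffter net over the (finite) group 'a with |'a| = 2k^2+1:
  point set a half-set V, parallel classes C 0, ..., C (r-1), each a (k^2,k)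
  Heffter system on V, and any two distinct blocks (as indexed members of the
  resolution) share at most one point (partial linear space).\<close>
definition heffter_net :: "nat \<Rightarrow> nat \<Rightarrow> 'a::ab_group_add set \<Rightarrow> (nat \<Rightarrow> 'a set set) \<Rightarrow> bool" where
  "heffter_net k r V C \<longleftrightarrow>
     finite (UNIV :: 'a set) \<and> card (UNIV :: 'a set) = 2 * k^2 + 1 \<and>
     half_set V \<and>
     (\<forall>i<r. heffter_system (k^2) k V (C i)) \<and>
     (\<forall>i<r. \<forall>j<r. \<forall>B\<in>C i. \<forall>B'\<in>C j. (i, B) \<noteq> (j, B') \<longrightarrow> card (B \<inter> B') \<le> 1)"

end

(*
  Let h generate the squares of F_{243}, a group of order 121, with h^5 = h + 1.  As -1 is not a
  square, the elements +-h^n with one choice of sign for each n mod 121 form a half-set.  Here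
  -h^n is taken when 11 divides n and h^n otherwise, so that the half-set is invariant under the
  group U generated by h^11.  Choosing a representative h^(t_i) of each U-coset, its points get
  coordinates (i, y) in (Z/11)^2, the point being +-h^(t_i + 11 y).  The U-cosets (vertical
  lines) form one Heffter system.  With a permutation P of Z/11, the lines y = m P(i) + d of a
  fixed slope m form a U-orbit, so they form a Heffter system as soon as the line with d = 0 sums
  to zero, and lines of different slopes meet in one point since 11 is prime.  The sum vanishes
  for eight slopes m.

  An F_3-linear isomorphism turns h^n into five consecutive terms of a nonzero solution of
  s(n+5) = s(n) + s(n+1) modulo 3; a vanishing sum of powers of h then has to be checked for five
  consecutive shifts only.
*)

theory Submission
  imports Defs "HOL-Number_Theory.Cong"
begin

section \<open>The recurrence modulo 3 and its finite checks\<close>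

fun shift_seq :: "int \<Rightarrow> int \<Rightarrow> int \<Rightarrow> int \<Rightarrow> int \<Rightarrow> nat \<Rightarrow> int" where
  "shift_seq a b c d e 0 = a"
| "shift_seq a b c d e (Suc n) = shift_seq b c d e (a + b) n"

definition seq :: "nat \<Rightarrow> int" where "seq = shift_seq 0 0 0 0 1"

text \<open>
  The data were found by computer.  With the sequence \<open>t\<^sub>i\<close> equivariant under multiplication by 3
  modulo 121 and \<open>P\<close> equivariant modulo 11, each line with \<open>d = 0\<close> is invariant under the
  Frobenius map, so its sum lies in the prime field and vanishes with probability 1/3.
\<close>

definition lift :: "nat list" where "lift = [0, 1, 79, 3, 81, 27, 116, 106, 107, 9, 76]"
definition ordinate :: "nat list" where "ordinate = [0, 1, 8, 3, 4, 5, 2, 6, 10, 9, 7]"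
definition slope :: "nat list" where "slope = [0, 3, 5, 6, 7, 8, 9, 10]"
definition coset_sign :: "nat \<Rightarrow> int" where "coset_sign i = (if i = 0 then -1 else 1)"

lemma lift_mod: "\<forall>i<11. lift ! i mod 11 = i"
  by code_simp

lemma ordinate_less: "\<forall>i<11. ordinate ! i < 11"
  by code_simp

lemma ordinate_inj: "\<forall>i<11. \<forall>j<11. ordinate ! i = ordinate ! j \<longrightarrow> i = j"
  by code_simp

lemma slope_less: "\<forall>c<8. slope ! c < 11"
  by code_simp

lemma slope_inj: "\<forall>c<8. \<forall>c'<8. slope ! c = slope ! c' \<longrightarrow> c = c'"
  by code_simp

text \<open>Lets the simplifier evaluate a term by sliding a window of five values, one step per
  index, where the plain recursion would branch.\<close>

lemma shift_seq_numeral: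
  "shift_seq a b c d e (numeral n) = shift_seq b c d e (a + b) (pred_numeral n)"
  by (simp add: numeral_eq_Suc)

lemma seq_rec: "seq (n + 5) = seq n + seq (n + 1)"
proof -
  have "shift_seq a b c d e (n + 5) = shift_seq a b c d e n + shift_seq a b c d e (n + 1)"
    for a b c d e
    by (induction n arbitrary: a b c d e)
      (simp_all add: numeral_eq_Suc add_Suc del: add_Suc_right)
  then show ?thesis by (simp add: seq_def)
qed

lemma less_5_cases: "k < 5 \<Longrightarrow> k = 0 \<or> k = 1 \<or> k = 2 \<or> k = 3 \<or> k = (4 :: nat)"
  by linarith

lemma less_8_cases:
  "c < 8 \<Longrightarrow> c = 0 \<or> c = 1 \<or> c = 2 \<or> c = 3 \<or> c = 4 \<or> c = 5 \<or> c = 6 \<or> c = (7 :: nat)"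
  by linarith

lemma sum_lessThan_11:
  "(\<Sum>i<11. f i) = f 0 + f 1 + f 2 + f 3 + f 4 + f 5 + f 6 + f 7 + f 8 + f 9 + f (10 :: nat)"
  for f :: "nat \<Rightarrow> int"
  by (simp add: eval_nat_numeral)

text \<open>This is h^121 = 1, checked in five consecutive terms.\<close>

lemma seq_121_init: "k < 5 \<Longrightarrow> 3 dvd seq (k + 121) - seq k"
  by (drule less_5_cases) (auto simp: seq_def shift_seq_numeral)

text \<open>Reducing the exponents modulo 121 keeps the evaluated indices small;
  \<open>seq_cong\<close> undoes the reduction in \<open>sum_block_point\<close>.\<close>

lemma line_sum_init:
  assumes "c < 8" "k < 5"
  shows "3 dvd (\<Sum>i<11. coset_sign i * seq (k + (lift ! i + 11 * (slope ! c * ordinate ! i)) mod 121))"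
  using less_8_cases[OF assms(1)] less_5_cases[OF assms(2)]
  by (elim disjE; simp add: sum_lessThan_11 lift_def ordinate_def slope_def coset_sign_def;
      simp add: seq_def shift_seq_numeral)

text \<open>The elements of U sum to zero; this serves the vertical lines.\<close>

lemma coset_sum_init: "k < 5 \<Longrightarrow> 3 dvd (\<Sum>i<11. seq (k + 11 * i))"
  by (drule less_5_cases) (elim disjE; simp add: sum_lessThan_11 seq_def shift_seq_numeral)

text \<open>Applies to every expression linear in shifts of \<open>seq\<close>: it yields the period
  121, the comparison of signed powers and the zero sums.\<close>

lemma dvd_recurrence:
  fixes f :: "nat \<Rightarrow> int"
  assumes rec: "\<And>n. f (n + 5) = f n + f (n + 1)" and init: "\<And>k. k < 5 \<Longrightarrow> q dvd f k"
  shows "q dvd f n"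
proof (induction n rule: less_induct)
  case (less n)
  show ?case
  proof (cases "n < 5")
    case False
    have "n - 5 + 5 = n" "n - 5 + 1 = n - 4" using False by simp_all
    then have "f n = f (n - 5) + f (n - 4)" using rec[of "n - 5"] by simp
    then show ?thesis using less.IH[of "n - 5"] less.IH[of "n - 4"] False by simp
  qed (use init in simp)
qed

lemma seq_cong:
  assumes "[a = b] (mod 121)"
  shows "[seq a = seq b] (mod 3)"
proof -
  have step: "[seq (n + 121) = seq n] (mod 3)" for n
  proof -
    have "3 dvd seq (n + 121) - seq n"
    proof (rule dvd_recurrence[where f = "\<lambda>n. seq (n + 121) - seq n"])
      fix n
      show "seq (n + 5 + 121) - seq (n + 5) = seq (n + 121) - seq n + (seq (n + 1 + 121) - seq (n + 1))"
        using seq_rec[of "n + 121"] seq_rec[of n] by (simp add: algebra_simps)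
    qed (use seq_121_init in blast)
    then show ?thesis by (simp add: cong_iff_dvd_diff)
  qed
  have shift: "[seq (n + 121 * q) = seq n] (mod 3)" for n q
  proof (induction q)
    case (Suc q)
    then show ?case using step[of "n + 121 * q"] cong_trans by (fastforce simp: algebra_simps)
  qed simp
  have "[seq n = seq (n mod 121)] (mod 3)" for n
    using shift[of "n mod 121" "n div 121"] by simp
  then show ?thesis using assms by (metis cong_def)
qed

text \<open>An arbitrary bijection, since the arithmetic of the index type 5 is irrelevant.\<close>

definition coord :: "5 \<Rightarrow> nat" where "coord = (SOME f. bij_betw f UNIV {..<5})"

lemma bij_coord: "bij_betw coord UNIV {..<5}"
  unfolding coord_def by (rule someI_ex[OF finite_same_card_bij]) auto

lemma coord_surj: "k < 5 \<Longrightarrow> \<exists>j. coord j = k"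
  using bij_coord by (metis bij_betw_imp_surj_on imageE lessThan_iff)

section \<open>Signed powers of h as vectors over F_3\<close>

definition seq_vec :: "int \<Rightarrow> nat \<Rightarrow> additive_GF243" where
  "seq_vec c n = (\<chi> j. of_int (c * seq (n + coord j)))"

lemma of_int_3_eq_0_iff: "of_int x = (0 :: 3) \<longleftrightarrow> 3 dvd x"
  using of_int_eq_0_iff_char_dvd[where 'a = 3, of x] by simp

lemma of_int_3_eq_iff: "of_int x = (of_int y :: 3) \<longleftrightarrow> [x = y] (mod 3)"
  using of_int_3_eq_0_iff[of "x - y"] by (simp add: cong_iff_dvd_diff)

lemma seq_vec_cong: "[a = b] (mod 121) \<Longrightarrow> seq_vec c a = seq_vec c b"
  by (auto simp: seq_vec_def vec_eq_iff of_int_3_eq_iff simp del: of_int_mult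
      intro!: cong_mult seq_cong cong_add)

lemma uminus_seq_vec: "- seq_vec c n = seq_vec (- c) n"
  by (simp add: seq_vec_def vec_eq_iff)

text \<open>The order of h is exactly 121 and -1 is not a power of h. Dividing one side by the other
  gives h^n = e with a sign \<open>e\<close>, and squaring removes the sign.\<close>

lemma seq_vec_eqD:
  assumes eq: "seq_vec c a = seq_vec c' b" and c: "c \<in> {1, -1}" "c' \<in> {1, -1}"
  shows "c = c' \<and> [a = b] (mod 121)"
proof -
  have init: "3 dvd c * seq (a + k) - c' * seq (b + k)" if "k < 5" for k
  proof -
    obtain j where j: "coord j = k" using coord_surj \<open>k < 5\<close> by blast
    have "seq_vec c a $ j = seq_vec c' b $ j" using eq by simp
    then show ?thesis
      by (simp add: seq_vec_def of_int_3_eq_iff cong_iff_dvd_diff j del: of_int_mult)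
  qed
  have all: "3 dvd c * seq (a + k) - c' * seq (b + k)" for k
  proof (rule dvd_recurrence[where f = "\<lambda>k. c * seq (a + k) - c' * seq (b + k)"])
    fix n
    show "c * seq (a + (n + 5)) - c' * seq (b + (n + 5)) =
        c * seq (a + n) - c' * seq (b + n) + (c * seq (a + (n + 1)) - c' * seq (b + (n + 1)))"
      using seq_rec[of "a + n"] seq_rec[of "b + n"] by (simp add: algebra_simps)
  qed (rule init)
  \<comment> \<open>As 120 is -1 modulo 121, \<open>n\<close> represents a - b without leaving the
    natural numbers.\<close>
  define n where "n = a + 120 * b"
  define e where "e = c * c'"
  have e: "e \<in> {1, -1}" using c by (auto simp: e_def)
  have n: "[seq (n + k) = e * seq k] (mod 3)" for k
  proof -
    have "[c * seq (n + k) = c' * seq (b + (120 * b + k))] (mod 3)"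
      using all[of "120 * b + k"] by (simp add: n_def cong_iff_dvd_diff add.assoc)
    moreover have "[c' * seq (b + (120 * b + k)) = c' * seq k] (mod 3)"
      by (intro cong_mult cong_refl seq_cong) (simp add: cong_def)
    ultimately have "[c * (c * seq (n + k)) = c * (c' * seq k)] (mod 3)"
      by (meson cong_mult cong_refl cong_trans)
    then show ?thesis using c by (auto simp: e_def)
  qed
  \<comment> \<open>The sequence has period \<open>2 n\<close> as well as 121. Unless 121 divides \<open>n\<close>, it would have period 11.\<close>
  have period: "[seq (2 * n * q + k) = seq k] (mod 3)" for q k
  proof (induction q)
    case (Suc q)
    have "[seq (n + (n + (2 * n * q + k))) = e * seq (n + (2 * n * q + k))] (mod 3)"
      by (rule n)
    also have "[e * seq (n + (2 * n * q + k)) = e * (e * seq (2 * n * q + k))] (mod 3)"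
      by (intro cong_mult cong_refl n)
    also have "e * (e * seq (2 * n * q + k)) = seq (2 * n * q + k)" using e by auto
    also note Suc.IH
    finally show ?case by (simp add: algebra_simps)
  qed simp
  have "121 dvd n"
  proof (rule ccontr)
    assume not_dvd: "\<not> 121 dvd n"
    let ?g = "gcd (2 * n) 121"
    have "?g dvd 11 ^ 2" by simp
    then obtain l where l: "l \<le> 2" "?g = 11 ^ l"
      using divides_primepow_nat[of 11 ?g 2] by auto
    have "l \<noteq> 2"
    proof
      assume "l = 2"
      then have "?g = 121" using l(2) by simp
      then have "121 dvd 2 * n" by (metis gcd_dvd1)
      moreover have "coprime 121 (2 :: nat)" by simp
      ultimately show False using not_dvd by (simp add: coprime_dvd_mult_right_iff)
    qed
    then have "?g dvd 11" using l le_imp_power_dvd[of l 1 "11 :: nat"] by simp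
    then obtain h where h: "11 = ?g * h" by (rule dvdE)
    have "n \<noteq> 0" using not_dvd by (metis dvd_0_right)
    then obtain x where "[2 * n * x = ?g] (mod 121)"
      using cong_solve_nat[of "2 * n" 121] by auto
    then have "[2 * n * x * h = 11] (mod 121)" using h cong_mult cong_refl by metis
    \<comment> \<open>The offset 4 exposes the contradiction: \<open>seq 4\<close> is 1, whereas
      \<open>seq 15\<close> is 0.\<close>
    then have "[seq (2 * n * (x * h) + 4) = seq (11 + 4)] (mod 3)"
      by (intro seq_cong cong_add cong_refl) (simp add: mult.assoc)
    then have "[seq (11 + 4) = seq 4] (mod 3)" using period cong_sym cong_trans by blast
    then show False by (simp add: seq_def shift_seq_numeral cong_def)
  qed
  \<comment> \<open>Now \<open>n\<close> is a period, and a term that is nonzero modulo 3 excludes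
    the sign -1.\<close>
  have "[seq 4 = seq (n + 4)] (mod 3)"
    using \<open>121 dvd n\<close> by (intro seq_cong) (auto simp: cong_def)
  then have "[seq 4 = e * seq 4] (mod 3)" using n cong_trans by blast
  then have "e = 1" using e by (auto simp: seq_def shift_seq_numeral cong_def)
  then have "c = c'" using c by (auto simp: e_def)
  moreover have "[n + b = 0 + b] (mod 121)"
    using \<open>121 dvd n\<close> by (intro cong_add cong_refl) (simp add: cong_0_iff)
  ultimately show ?thesis by (simp add: n_def cong_def)
qed

section \<open>Coordinates on the points and the half-set property\<close>

definition point :: "nat \<Rightarrow> nat \<Rightarrow> additive_GF243" where
  "point i y = seq_vec (coset_sign i) (lift ! i + 11 * y)"

lemma coset_sign_cases: "coset_sign i \<in> {1, -1}"
  by (simp add: coset_sign_def)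

text \<open>Modulo 11 the multiples of 11 drop out, so the exponent determines its U-coset.\<close>

lemma lift_cong_imp_eq:
  assumes "i < 11" "i' < 11" "[lift ! i + 11 * y = lift ! i' + 11 * y'] (mod 121)"
  shows "i = i'"
proof -
  have "[lift ! i + 11 * y = lift ! i' + 11 * y'] (mod 11)"
    by (rule cong_dvd_modulus_nat[OF assms(3)]) simp
  then show ?thesis using lift_mod assms(1,2) by (simp add: cong_def)
qed

lemma point_eq_iff:
  assumes "i < 11" "i' < 11"
  shows "point i y = point i' y' \<longleftrightarrow> i = i' \<and> [y = y'] (mod 11)"
proof -
  have *: "[lift ! i + 11 * y = lift ! i + 11 * y'] (mod 121) \<longleftrightarrow> [y = y'] (mod 11)"
    using mod_mult_mult1[of 11 y 11] mod_mult_mult1[of 11 y' 11]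
    by (simp add: cong_add_lcancel_nat) (simp add: cong_def)
  show ?thesis
    unfolding point_def using * seq_vec_eqD[OF _ coset_sign_cases coset_sign_cases] seq_vec_cong
      lift_cong_imp_eq[OF assms]
    by metis
qed

text \<open>A zero sum would equate signed powers of h, forcing equal cosets and opposite signs, but
  the sign is constant on a coset.\<close>

lemma point_add_neq_0:
  assumes "i < 11" "i' < 11"
  shows "point i y + point i' y' \<noteq> 0"
proof
  assume "point i y + point i' y' = 0"
  then have "seq_vec (coset_sign i) (lift ! i + 11 * y) = seq_vec (- coset_sign i') (lift ! i' + 11 * y')"
    by (simp add: point_def eq_neg_iff_add_eq_0 flip: uminus_seq_vec)
  moreover have "- coset_sign i' \<in> {1, -1}" by (simp add: coset_sign_def)
  ultimately have "coset_sign i = - coset_sign i'" "i = i'"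
    using seq_vec_eqD coset_sign_cases lift_cong_imp_eq[OF assms] by blast+
  then show False by (simp add: coset_sign_def split: if_splits)
qed

definition points :: "additive_GF243 set" where
  "points = (\<lambda>(i, y). point i y) ` ({..<11} \<times> {..<11})"

lemma point_in_points: "i < 11 \<Longrightarrow> point i y \<in> points"
  using point_eq_iff[of i i y "y mod 11"]
  by (auto simp: points_def intro!: image_eqI[of _ _ "(i, y mod 11)"])

lemma card_points: "card points = 121"
proof -
  have "inj_on (\<lambda>(i, y). point i y) ({..<11} \<times> {..<11})"
    by (auto simp: inj_on_def point_eq_iff cong_less_modulus_unique_nat)
  then show ?thesis by (simp add: points_def card_image card_cartesian_product)
qed

text \<open>By counting: V, -V and 0 are disjoint and together have as many elements as the
  group.\<close>

lemma half_setI: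
  fixes V :: "'a::ab_group_add set"
  assumes fin: "finite (UNIV :: 'a set)" and card: "card (UNIV :: 'a set) = 2 * card V + 1"
    and add: "\<And>x y. x \<in> V \<Longrightarrow> y \<in> V \<Longrightarrow> x + y \<noteq> 0"
  shows "half_set V"
proof -
  have "0 \<notin> V" using add[of 0 0] by auto
  have disj: "V \<inter> uminus ` V = {}" using add by force
  have finV: "finite V" using fin by (rule finite_subset[rotated]) simp
  have "card (insert 0 (V \<union> uminus ` V)) = Suc (card (V \<union> uminus ` V))"
    using \<open>0 \<notin> V\<close> finV by (subst card_insert_disjoint) auto
  also have "card (V \<union> uminus ` V) = card V + card (uminus ` V)"
    using finV disj by (intro card_Un_disjoint) auto
  also have "card (uminus ` V) = card V" by (simp add: card_image)
  finally have "insert 0 (V \<union> uminus ` V) = UNIV"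
    using fin card by (intro card_subset_eq) auto
  then have "g \<in> V \<or> - g \<in> V" if "g \<noteq> 0" for g
    using that by (metis Un_iff UNIV_I imageE insertE minus_minus)
  then show ?thesis
    unfolding half_set_def using \<open>0 \<notin> V\<close> add by (metis add.right_inverse)
qed

section \<open>Lines and their intersections\<close>

text \<open>The index 8, just past the entries of \<open>slope\<close>, stands for the vertical
  class; there \<open>d\<close> is the abscissa and \<open>i\<close> runs along the line as
  ordinate.\<close>

definition block_point :: "nat \<Rightarrow> nat \<Rightarrow> nat \<Rightarrow> additive_GF243" where
  "block_point c d i = (if c = 8 then point d i else point i (slope ! c * ordinate ! i + d))"

definition parallel_class :: "nat \<Rightarrow> additive_GF243 set set" where
  "parallel_class c = (\<lambda>d. block_point c d ` {..<11}) ` {..<11}"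

lemma block_point_in_points: "d < 11 \<Longrightarrow> i < 11 \<Longrightarrow> block_point c d i \<in> points"
  by (simp add: block_point_def point_in_points)

lemma block_point_inj:
  assumes "d < 11" "i < 11" "d' < 11" "i' < 11" "block_point c d i = block_point c d' i'"
  shows "d = d' \<and> i = i'"
proof (cases "c = 8")
  case True
  then show ?thesis using assms by (auto simp: block_point_def point_eq_iff cong_less_modulus_unique_nat)
next
  case False
  then show ?thesis
    using assms by (auto simp: block_point_def point_eq_iff cong_add_lcancel_nat cong_less_modulus_unique_nat)
qed

lemma prime_11: "prime (11 :: int)"
  by simp

text \<open>Subtracting the congruences eliminates \<open>d\<close> and \<open>d'\<close>: 11
  divides a difference of slopes times a difference of ordinates. The slopes are distinct and
  \<open>ordinate\<close> is injective.\<close>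

lemma lines_meet_once:
  assumes c: "c < 8" "c' < 8" "c \<noteq> c'" and ij: "i < 11" "j < 11"
    and i: "[slope ! c * ordinate ! i + d = slope ! c' * ordinate ! i + d'] (mod 11)"
    and j: "[slope ! c * ordinate ! j + d = slope ! c' * ordinate ! j + d'] (mod 11)"
  shows "i = j"
proof -
  have eq0_if: "x = y" if "11 dvd int x - int y" "x < 11" "y < 11" for x y
    using that by (metis cong_iff_dvd_diff cong_int_iff cong_less_modulus_unique_nat of_nat_numeral)
  let ?m = "int (slope ! c) - int (slope ! c')" and ?P = "int (ordinate ! i) - int (ordinate ! j)"
  have "11 dvd int (slope ! c * ordinate ! k + d) - int (slope ! c' * ordinate ! k + d')"
    if "k \<in> {i, j}" for k
    using that i j by (auto simp flip: cong_int_iff simp: cong_iff_dvd_diff)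
  from dvd_diff[OF this[of i] this[of j]]
  have "11 dvd (int (slope ! c * ordinate ! i + d) - int (slope ! c' * ordinate ! i + d'))
      - (int (slope ! c * ordinate ! j + d) - int (slope ! c' * ordinate ! j + d'))"
    by simp
  also have "\<dots> = ?m * ?P" by (simp add: algebra_simps)
  finally have "11 dvd ?m \<or> 11 dvd ?P"
    using prime_11 by (simp add: prime_dvd_mult_iff)
  then show ?thesis
    using eq0_if slope_less slope_inj ordinate_less ordinate_inj c ij by metis
qed

lemma block_common_points:
  assumes c: "c < 9" "c' < 9" "c \<noteq> c'"
    and less: "d < 11" "d' < 11" "i < 11" "i' < 11" "j < 11" "j' < 11"
    and eq: "block_point c d i = block_point c' d' i'" "block_point c d j = block_point c' d' j'"
  shows "i = j"
proof -
  consider "c = 8" "c' < 8" | "c < 8" "c' = 8" | "c < 8" "c' < 8" using c by linarith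
  then show ?thesis
  proof cases
    case 1
    \<comment> \<open>A non-vertical line has only one point with abscissa \<open>d\<close>.\<close>
    then have "i' = d" "j' = d" using eq less by (auto simp: block_point_def point_eq_iff)
    then have "block_point c d i = block_point c d j" using eq by simp
    then show ?thesis using block_point_inj less by blast
  next
    case 2
    then show ?thesis using eq less by (auto simp: block_point_def point_eq_iff)
  next
    case 3
    then show ?thesis using eq less c(3) lines_meet_once[of c c' i j d d']
      by (auto simp: block_point_def point_eq_iff)
  qed
qed

section \<open>Vanishing block sums\<close>

lemma point_nth: "point i y $ j = of_int (coset_sign i * seq (lift ! i + 11 * y + coord j))"
  by (simp add: point_def seq_vec_def)

lemma sum_point_eq_0:
  assumes "\<And>k. 3 dvd (\<Sum>i\<in>I. coset_sign (f i) * seq (lift ! f i + 11 * g i + k))"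
  shows "(\<Sum>i\<in>I. point (f i) (g i)) = 0"
  using assms by (simp add: vec_eq_iff point_nth of_int_3_eq_0_iff flip: of_int_sum of_int_mult)

lemma sum_block_point:
  assumes "c < 9"
  shows "(\<Sum>i<11. block_point c d i) = 0"
proof (cases "c = 8")
  case True
  have *: "3 dvd (\<Sum>i<11. seq (k + 11 * i))" for k
  proof (rule dvd_recurrence[where f = "\<lambda>k. \<Sum>i<11. seq (k + 11 * i)"])
    fix n
    show "(\<Sum>i<11. seq (n + 5 + 11 * i)) = (\<Sum>i<11. seq (n + 11 * i)) + (\<Sum>i<11. seq (n + 1 + 11 * i))"
      unfolding sum.distrib[symmetric]
    proof (rule sum.cong)
      fix i :: nat assume "i \<in> {..<11}"
      show "seq (n + 5 + 11 * i) = seq (n + 11 * i) + seq (n + 1 + 11 * i)"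
        using seq_rec[of "n + 11 * i"] by (simp add: algebra_simps)
    qed simp
  qed (use coset_sum_init in blast)
  have "(\<Sum>i<11. point d i) = 0"
  proof (rule sum_point_eq_0)
    fix k
    have "(\<Sum>i<11. coset_sign d * seq (lift ! d + 11 * i + k)) =
        coset_sign d * (\<Sum>i<11. seq ((lift ! d + k) + 11 * i))"
      by (simp add: sum_distrib_left algebra_simps)
    then show "3 dvd (\<Sum>i<11. coset_sign d * seq (lift ! d + 11 * i + k))" using * by simp
  qed
  then show ?thesis using True by (simp add: block_point_def)
next
  case False
  define e where "e i = lift ! i + 11 * (slope ! c * ordinate ! i)" for i
  have *: "3 dvd (\<Sum>i<11. coset_sign i * seq (k + e i))" for k
  proof (rule dvd_recurrence[where f = "\<lambda>k. \<Sum>i<11. coset_sign i * seq (k + e i)"])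
    fix n
    show "(\<Sum>i<11. coset_sign i * seq (n + 5 + e i)) =
        (\<Sum>i<11. coset_sign i * seq (n + e i)) + (\<Sum>i<11. coset_sign i * seq (n + 1 + e i))"
      unfolding sum.distrib[symmetric]
    proof (rule sum.cong)
      fix i :: nat assume "i \<in> {..<11}"
      show "coset_sign i * seq (n + 5 + e i) = coset_sign i * seq (n + e i) + coset_sign i * seq (n + 1 + e i)"
        using seq_rec[of "n + e i"] by (simp add: algebra_simps)
    qed simp
  next
    fix k :: nat assume k: "k < 5"
    let ?f = "\<lambda>i. k + (lift ! i + 11 * (slope ! c * ordinate ! i)) mod 121"
    have "[k + e i = ?f i] (mod 121)" for i
      by (simp add: e_def cong_def mod_simps)
    then have "[(\<Sum>i<11. coset_sign i * seq (k + e i)) = (\<Sum>i<11. coset_sign i * seq (?f i))] (mod 3)"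
      by (intro cong_sum cong_mult cong_refl seq_cong)
    moreover have "3 dvd (\<Sum>i<11. coset_sign i * seq (?f i))"
      using line_sum_init k False assms by simp
    ultimately show "3 dvd (\<Sum>i<11. coset_sign i * seq (k + e i))"
      by (simp add: cong_dvd_iff)
  qed
  have "(\<Sum>i<11. point i (slope ! c * ordinate ! i + d)) = 0"
  proof (rule sum_point_eq_0)
    fix k
    show "3 dvd (\<Sum>i<11. coset_sign i * seq (lift ! i + 11 * (slope ! c * ordinate ! i + d) + k))"
      \<comment> \<open>Translating the line by \<open>d\<close> multiplies its sum by h^(11 d),
        which is a mere shift of the sequence.\<close>
      using *[of "11 * d + k"] by (simp add: e_def algebra_simps)
  qed
  then show ?thesis using False by (simp add: block_point_def)
qed

section \<open>Partitions and assembly of the net\<close>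

lemma partition_on_rows:
  assumes bij: "bij_betw (\<lambda>(d, i). f d i) (D \<times> I) V" and "I \<noteq> {}"
  shows "partition_on V ((\<lambda>d. f d ` I) ` D)"
proof (rule partition_onI)
  show "\<Union> ((\<lambda>d. f d ` I) ` D) = V"
    using bij_betw_imp_surj_on[OF bij] by force
  fix A B assume "A \<in> (\<lambda>d. f d ` I) ` D" "B \<in> (\<lambda>d. f d ` I) ` D" "A \<noteq> B"
  then obtain d e where d: "d \<in> D" "A = f d ` I" and e: "e \<in> D" "B = f e ` I" and "d \<noteq> e"
    by blast
  have "f d i \<noteq> f e j" if "i \<in> I" "j \<in> I" for i j
    using inj_onD[OF bij_betw_imp_inj_on[OF bij], of "(d, i)" "(e, j)"] d(1) e(1) \<open>d \<noteq> e\<close> that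
    by auto
  then show "disjnt A B" by (auto simp: disjnt_def d(2) e(2))
qed (use \<open>I \<noteq> {}\<close> in auto)

lemma heffter_system_parallel_class:
  assumes "c < 9"
  shows "heffter_system (11\<^sup>2) 11 points (parallel_class c)"
proof -
  have inj: "inj_on (\<lambda>(d, i). block_point c d i) ({..<11} \<times> {..<11})"
    unfolding inj_on_def using block_point_inj by (simp add: Ball_def split_paired_all) blast
  \<comment> \<open>Surjectivity by counting: an 11 by 11 grid is mapped injectively into 121
    points.\<close>
  have "(\<lambda>(d, i). block_point c d i) ` ({..<11} \<times> {..<11}) = points"
  proof (rule card_subset_eq)
    show "finite points" by (simp add: points_def)
    show "(\<lambda>(d, i). block_point c d i) ` ({..<11} \<times> {..<11}) \<subseteq> points" by (auto simp: block_point_in_points)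
    show "card ((\<lambda>(d, i). block_point c d i) ` ({..<11} \<times> {..<11})) = card points"
      by (simp add: card_image[OF inj] card_points)
  qed
  then have "partition_on points (parallel_class c)"
    unfolding parallel_class_def using inj
    by (intro partition_on_rows) (auto simp: bij_betw_def lessThan_empty_iff)
  moreover have "card B = 11 \<and> \<Sum>B = 0" if "B \<in> parallel_class c" for B
  proof -
    obtain d where d: "d < 11" "B = block_point c d ` {..<11}"
      using \<open>B \<in> parallel_class c\<close> by (auto simp: parallel_class_def)
    have "inj_on (block_point c d) {..<11}"
      using d(1) block_point_inj by (intro inj_onI) blast
    then show ?thesis using sum_block_point[OF assms] by (simp add: d(2) card_image sum.reindex)
  qed
  ultimately show ?thesis by (simp add: heffter_system_def card_points)
qed

lemma card_block_Int_le_1: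
  assumes c: "c < 9" "c' < 9" and B: "B \<in> parallel_class c" "B' \<in> parallel_class c'"
    and neq: "(c, B) \<noteq> (c', B')"
  shows "card (B \<inter> B') \<le> 1"
proof -
  obtain d d' where d: "d < 11" "B = block_point c d ` {..<11}"
    and d': "d' < 11" "B' = block_point c' d' ` {..<11}"
    using B by (auto simp: parallel_class_def)
  have "x = y" if xy: "x \<in> B \<inter> B'" "y \<in> B \<inter> B'" for x y
  proof (cases "c = c'")
    case True
    \<comment> \<open>Within one class a common point forces \<open>d = d'\<close>, making the two
      blocks equal.\<close>
    then show ?thesis using xy d d' neq block_point_inj by blast
  next
    case False
    obtain i i' j j' where *: "i < 11" "i' < 11" "j < 11" "j' < 11"
      "x = block_point c d i" "x = block_point c' d' i'" "y = block_point c d j" "y = block_point c' d' j'"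
      using xy d d' by auto
    have "i = j"
      by (rule block_common_points[OF c False d(1) d'(1), of i i' j j']) (use * in auto)
    then show ?thesis using * by simp
  qed
  then show ?thesis
    using card_le_Suc0_iff_eq[of "B \<inter> B'"] d(2) by auto
qed

theorem theorem5p3:
  shows "\<exists>(V :: additive_GF243 set) C. heffter_net 11 9 V C"
proof (intro exI)
  have card: "card (UNIV :: additive_GF243 set) = 243"
    by (simp add: CARD_vec)
  have "half_set points"
  proof (rule half_setI)
    show "x + y \<noteq> 0" if "x \<in> points" "y \<in> points" for x y
      using that point_add_neq_0 by (auto simp: points_def)
  qed (simp_all add: card card_points)
  then show "heffter_net 11 9 points parallel_class"
    unfolding heffter_net_def
    using card heffter_system_parallel_class card_block_Int_le_1 by auto
qed

end
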